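(* Let $\mathcal A,\mathcal B$ be (binary) unital associative algebras over $\mathbb C$ with involutions $a\mapsto a^\star$ and $b\mapsto b^\ast$ respectively, let $\mathcal M$ be an $\mathcal A$-$\mathcal B$-bimodule with associated $\mathcal B$-$\mathcal A$-bimodule $\overline{\mathcal M}$, and let $\varphi:\mathcal M\otimes_{\mathcal B}\overline{\mathcal M}\to\mathcal A$ and $\psi:\overline{\mathcal M}\otimes_{\mathcal A}\mathcal M\to\mathcal B$ be homomorphisms of $\mathcal A$-bimodules and of $\mathcal B$-bimodules respectively such that for all $m,n,p\in\mathcal M$ $$(\varphi(m\otimes\bar n))^\star=\varphi(n\otimes\bar m),\quad(\psi(\bar m\otimes n))^\ast=\psi(\bar n\otimes m),\quad\varphi(m\otimes\bar n)\cdot p=m\cdot\psi(\bar n\otimes p).$$ Let $\mathrm{Mat}_2(\mathcal A,\mathcal B,\mathcal M)$ be the vector space of all $2\times2$ matrices $\begin{pmatrix}a&m\\ \bar n&b\end{pmatrix}$ with $a\in\mathcal A$, $b\in\mathcal B$, $m\in\mathcal M$, $\bar n\in\overline{\mathcal M}$, endowed with the multiplication $$\begin{pmatrix}a&m\\ \bar n&b\end{pmatrix}\begin{pmatrix}a'&m'\\ \bar n'&b'\end{pmatrix}=\begin{pmatrix}a\,a'+\varphi(m\otimes\bar n')&a\cdot m'+m\cdot b'\\ \bar n\cdot a'+b\cdot\bar n'&b\,b'+\psi(\bar n\otimes m')\end{pmatrix}.$$ Then $\mathrm{Mat}_2(\mathcal A,\mathcal B,\mathcal M)$ is a unital associative (binary)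 algebra with unity element $E=\begin{pmatrix}e&0\\ \bar 0&e'\end{pmatrix}$, where $e$ is the unity element of $\mathcal A$ and $e'$ is the unity element of $\mathcal B$.
   Context: The bimodule $\mathcal M$ is regarded as a vector space over $\mathbb C$. $\overline{\mathcal M}$ is an abelian group isomorphic to the abelian group $\mathcal M$ via an isomorphism $\varepsilon:\mathcal M\to\overline{\mathcal M}$, written $\varepsilon(m)=\bar m$, and it is made into a $\mathcal B$-$\mathcal A$-bimodule by $\varepsilon(m)\cdot a=\varepsilon(a^\star\cdot m)$ and $b\cdot\varepsilon(m)=\varepsilon(m\cdot b^\ast)$ for $m\in\mathcal M$, $a\in\mathcal A$, $b\in\mathcal B$. The tensor product $\mathcal M\otimes_{\mathcal B}\overline{\mathcal M}$ is an $\mathcal A$-bimodule and $\overline{\mathcal M}\otimes_{\mathcal A}\mathcal M$ is a $\mathcal B$-bimodule, and $\mathcal A$, $\mathcal B$ are regarded as bimodules over themselves. *)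

theory Defs
  imports Complex_Main "HOL-Algebra.Free_Abelian_Groups"
begin

section \<open>Algebras, involutions, bimodules\<close>

text \<open>Additive groups are types of class \<open>ab_group_add\<close>; scalar multiplications, products, units and
  module actions are explicit parameters. The zero algebra is not excluded.\<close>

locale unital_assoc_algebra = vector_space scale
  for scale :: "complex \<Rightarrow> 'a::ab_group_add \<Rightarrow> 'a" +
  fixes mult :: "'a \<Rightarrow> 'a \<Rightarrow> 'a" and unit :: 'a
  assumes mult_add_left: "mult (x + y) z = mult x z + mult y z"
    and mult_add_right: "mult x (y + z) = mult x y + mult x z"
    and mult_scale_left: "mult (scale c x) y = scale c (mult x y)"
    and mult_scale_right: "mult x (scale c y) = scale c (mult x y)"
    and mult_assoc: "mult (mult x y) z = mult x (mult y z)"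
    and mult_unit_left: "mult unit x = x"
    and mult_unit_right: "mult x unit = x"

text \<open>The parameter \<open>\<sigma>\<close> is \<open>cnj\<close> for conjugate-linear and \<open>id\<close> for complex-linear involutions.\<close>

locale involutive_algebra = unital_assoc_algebra scale mult unit
  for \<sigma> :: "complex \<Rightarrow> complex"
    and scale :: "complex \<Rightarrow> 'a::ab_group_add \<Rightarrow> 'a" and mult unit +
  fixes star :: "'a \<Rightarrow> 'a"
  assumes star_add: "star (x + y) = star x + star y"
    and star_scale: "star (scale c x) = scale (\<sigma> c) (star x)"
    and star_mult: "star (mult x y) = mult (star y) (star x)"
    and star_star: "star (star x) = x"

locale bimodule =
  A: unital_assoc_algebra sA mA eA + B: unital_assoc_algebra sB mB eB + vector_space sM
  for sA :: "complex \<Rightarrow> 'a::ab_group_add \<Rightarrow> 'a" and mA eA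
    and sB :: "complex \<Rightarrow> 'b::ab_group_add \<Rightarrow> 'b" and mB eB
    and sM :: "complex \<Rightarrow> 'm::ab_group_add \<Rightarrow> 'm" +
  fixes lM :: "'a \<Rightarrow> 'm \<Rightarrow> 'm" and rM :: "'m \<Rightarrow> 'b \<Rightarrow> 'm"
  assumes l_add_left: "lM (a + a') m = lM a m + lM a' m"
    and l_add_right: "lM a (m + m') = lM a m + lM a m'"
    and l_scale_left: "lM (sA c a) m = sM c (lM a m)"
    and l_scale_right: "lM a (sM c m) = sM c (lM a m)"
    and l_mult: "lM (mA a a') m = lM a (lM a' m)"
    and l_unit: "lM eA m = m"
    and r_add_left: "rM (m + m') b = rM m b + rM m' b"
    and r_add_right: "rM m (b + b') = rM m b + rM m b'"
    and r_scale_left: "rM (sM c m) b = sM c (rM m b)"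
    and r_scale_right: "rM m (sB c b) = sM c (rM m b)"
    and r_mult: "rM m (mB b b') = rM (rM m b) b'"
    and r_unit: "rM m eB = m"
    and lr_assoc: "rM (lM a m) b = lM a (rM m b)"

text \<open>The group \<open>'n\<close> plays the role of the conjugate of \<open>M\<close>. Its actions are those transported
  along \<open>\<epsilon>\<close> and twisted by the involutions; the scalar multiplication is the only one for which
  the result is a bimodule over the complex algebras \<open>B\<close> and \<open>A\<close> (see
  \<open>conjugate_bimodule_is_bimodule\<close>): \<open>c\<close> has to act as \<open>c\<close> times the unit.\<close>

locale conjugate_bimodule =
  fixes \<sigma> :: "complex \<Rightarrow> complex" and starA :: "'a \<Rightarrow> 'a" and starB :: "'b \<Rightarrow> 'b"
    and sM :: "complex \<Rightarrow> 'm::ab_group_add \<Rightarrow> 'm"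
    and lM :: "'a \<Rightarrow> 'm \<Rightarrow> 'm" and rM :: "'m \<Rightarrow> 'b \<Rightarrow> 'm"
    and \<epsilon> :: "'m \<Rightarrow> 'n::ab_group_add"
    and sN :: "complex \<Rightarrow> 'n \<Rightarrow> 'n"
    and lN :: "'b \<Rightarrow> 'n \<Rightarrow> 'n" and rN :: "'n \<Rightarrow> 'a \<Rightarrow> 'n"
  assumes bij_eps: "bij \<epsilon>"
    and eps_add: "\<epsilon> (m + m') = \<epsilon> m + \<epsilon> m'"
    and scale_eps: "sN c (\<epsilon> m) = \<epsilon> (sM (\<sigma> c) m)"
    and eps_act: "rN (\<epsilon> m) a = \<epsilon> (lM (starA a) m)"
    and act_eps: "lN b (\<epsilon> m) = \<epsilon> (rM m (starB b))"

lemma conjugate_bimodule_is_bimodule: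
  assumes \<sigma>: "\<sigma> = id \<or> \<sigma> = cnj"
    and A: "involutive_algebra \<sigma> sA mA eA starA" and B: "involutive_algebra \<sigma> sB mB eB starB"
    and M: "bimodule sA mA eA sB mB eB sM lM rM"
    and N: "conjugate_bimodule \<sigma> starA starB sM lM rM \<epsilon> sN lN rN"
  shows "bimodule sB mB eB sA mA eA sN lN rN"
proof -
  interpret A: involutive_algebra \<sigma> sA mA eA starA by fact
  interpret B: involutive_algebra \<sigma> sB mB eB starB by fact
  interpret M: bimodule sA mA eA sB mB eB sM lM rM by fact
  interpret N: conjugate_bimodule \<sigma> starA starB sM lM rM \<epsilon> sN lN rN by fact
  have s: "\<sigma> (c + d) = \<sigma> c + \<sigma> d" "\<sigma> (c * d) = \<sigma> c * \<sigma> d" "\<sigma> 1 = 1" "\<sigma> (\<sigma> c) = c" for c d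
    using \<sigma> by auto
  have uA: "starA eA = eA"
    by (metis A.mult_unit_left A.mult_unit_right A.star_mult A.star_star)
  have uB: "starB eB = eB"
    by (metis B.mult_unit_left B.mult_unit_right B.star_mult B.star_star)
  have surj: "\<exists>m. n = \<epsilon> m" for n
    using bij_is_surj[OF N.bij_eps] by (simp add: surj_def)
  note eqs = N.scale_eps N.eps_act N.act_eps N.eps_add[symmetric]
    A.star_add A.star_scale A.star_mult B.star_add B.star_scale B.star_mult uA uB s
    M.l_add_left M.l_add_right M.l_scale_left M.l_scale_right M.l_mult M.l_unit
    M.r_add_left M.r_add_right M.r_scale_left M.r_scale_right M.r_mult M.r_unit M.lr_assoc
    M.vector_space_assms
  have 1: "sN c (n + n') = sN c n + sN c n'" "rN (n + n') a = rN n a + rN n' a"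
    "lN b (n + n') = lN b n + lN b n'" for c n n' a b
    using surj[of n] surj[of n'] by (auto simp: eqs)
  have 2: "sN (c + d) n = sN c n + sN d n" "sN c (sN d n) = sN (c * d) n" "sN 1 n = n"
    "lN (b + b') n = lN b n + lN b' n" "lN (sB c b) n = sN c (lN b n)"
    "lN b (sN c n) = sN c (lN b n)" "lN (mB b b') n = lN b (lN b' n)" "lN eB n = n"
    "rN n (a + a') = rN n a + rN n a'" "rN (sN c n) a = sN c (rN n a)"
    "rN n (sA c a) = sN c (rN n a)" "rN n (mA a a') = rN (rN n a) a'" "rN n eA = n"
    "rN (lN b n) a = lN b (rN n a)" for n c d b b' a a'
    using surj[of n] by (auto simp: eqs)
  show ?thesis
    by unfold_locales (simp_all only: 1 2)
qed


section \<open>Tensor products over a not necessarily commutative algebra\<close>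

text \<open>\<open>balancing_relators r l\<close> are the relators of the tensor product of a right module with action
  \<open>r\<close> and a left module with action \<open>l\<close>. Complex-bilinearity need not be imposed: scalars
  act as multiples of the unit of the algebra, so they are moved across by the last relator.\<close>

definition balancing_relators ::
    "('m::ab_group_add \<Rightarrow> 'b \<Rightarrow> 'm) \<Rightarrow> ('b \<Rightarrow> 'n::ab_group_add \<Rightarrow> 'n) \<Rightarrow> ('m \<times> 'n \<Rightarrow>\<^sub>0 int) set" where
  "balancing_relators r l =
     {frag_of (m + m', n) - frag_of (m, n) - frag_of (m', n) | m m' n. True} \<union>
     {frag_of (m, n + n') - frag_of (m, n) - frag_of (m, n') | m n n'. True} \<union>
     {frag_of (r m b, n) - frag_of (m, l b n) | m b n. True}"

definition balancing_subgroup ::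
    "('m::ab_group_add \<Rightarrow> 'b \<Rightarrow> 'm) \<Rightarrow> ('b \<Rightarrow> 'n::ab_group_add \<Rightarrow> 'n) \<Rightarrow> ('m \<times> 'n \<Rightarrow>\<^sub>0 int) set" where
  "balancing_subgroup r l = generate (free_Abelian_group UNIV) (balancing_relators r l)"

definition tensor_group ::
    "('m::ab_group_add \<Rightarrow> 'b \<Rightarrow> 'm) \<Rightarrow> ('b \<Rightarrow> 'n::ab_group_add \<Rightarrow> 'n) \<Rightarrow> ('m \<times> 'n \<Rightarrow>\<^sub>0 int) set monoid" where
  "tensor_group r l = free_Abelian_group UNIV Mod balancing_subgroup r l"

definition pure_tensor ::
    "('m::ab_group_add \<Rightarrow> 'b \<Rightarrow> 'm) \<Rightarrow> ('b \<Rightarrow> 'n::ab_group_add \<Rightarrow> 'n) \<Rightarrow> 'm \<Rightarrow> 'n \<Rightarrow> ('m \<times> 'n \<Rightarrow>\<^sub>0 int) set" where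
  "pure_tensor r l m n = balancing_subgroup r l #>\<^bsub>free_Abelian_group UNIV\<^esub> frag_of (m, n)"

text \<open>The map induced on cosets by \<open>(m, n) \<mapsto> (f m, g n)\<close>, meant for \<open>f\<close> and \<open>g\<close> that are
  additive and commute with \<open>r\<close> and \<open>l\<close> (see \<open>tensor_map_pure_tensor\<close>, \<open>tensor_map_add\<close>).\<close>

definition tensor_map ::
    "('m::ab_group_add \<Rightarrow> 'b \<Rightarrow> 'm) \<Rightarrow> ('b \<Rightarrow> 'n::ab_group_add \<Rightarrow> 'n) \<Rightarrow> ('m \<Rightarrow> 'm) \<Rightarrow> ('n \<Rightarrow> 'n) \<Rightarrow>
     ('m \<times> 'n \<Rightarrow>\<^sub>0 int) set \<Rightarrow> ('m \<times> 'n \<Rightarrow>\<^sub>0 int) set" where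
  "tensor_map r l f g X =
     (\<Union>x\<in>X. balancing_subgroup r l #>\<^bsub>free_Abelian_group UNIV\<^esub>
              frag_extend (\<lambda>(m, n). frag_of (f m, g n)) x)"

text \<open>For an \<open>A\<close>-\<open>B\<close>-bimodule with actions \<open>lM\<close>, \<open>rM\<close> and a \<open>B\<close>-\<open>A\<close>-bimodule with actions \<open>lN\<close>,
  \<open>rN\<close>: homomorphisms of \<open>A\<close>-bimodules from their tensor product over \<open>B\<close> to the regular bimodule of
  the algebra \<open>A\<close> with product \<open>mA\<close>. Complex-linearity follows from linearity over the unit.\<close>

definition tensor_bimodule_hom ::
    "('a \<Rightarrow> 'm::ab_group_add \<Rightarrow> 'm) \<Rightarrow> ('m \<Rightarrow> 'b \<Rightarrow> 'm) \<Rightarrow>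
     ('b \<Rightarrow> 'n::ab_group_add \<Rightarrow> 'n) \<Rightarrow> ('n \<Rightarrow> 'a \<Rightarrow> 'n) \<Rightarrow> ('a::ab_group_add \<Rightarrow> 'a \<Rightarrow> 'a) \<Rightarrow>
     (('m \<times> 'n \<Rightarrow>\<^sub>0 int) set \<Rightarrow> 'a) \<Rightarrow> bool" where
  "tensor_bimodule_hom lM rM lN rN mA \<phi> \<longleftrightarrow>
     (\<forall>X \<in> carrier (tensor_group rM lN). \<forall>Y \<in> carrier (tensor_group rM lN).
        \<phi> (X \<otimes>\<^bsub>tensor_group rM lN\<^esub> Y) = \<phi> X + \<phi> Y) \<and>
     (\<forall>a. \<forall>X \<in> carrier (tensor_group rM lN).
        \<phi> (tensor_map rM lN (lM a) id X) = mA a (\<phi> X)) \<and>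
     (\<forall>a. \<forall>X \<in> carrier (tensor_group rM lN).
        \<phi> (tensor_map rM lN id (\<lambda>n. rN n a) X) = mA (\<phi> X) a)"

lemma carrier_free_UNIV [simp]: "carrier (free_Abelian_group UNIV) = UNIV"
  by (auto simp: free_Abelian_group_def)

lemma balancing_subgroup_normal:
  "balancing_subgroup r l \<lhd> free_Abelian_group UNIV"
proof -
  interpret F: comm_group "free_Abelian_group UNIV"
    by (rule abelian_free_Abelian_group)
  show ?thesis
    unfolding balancing_subgroup_def
    by (intro F.subgroup_imp_normal F.generate_is_subgroup) simp
qed

lemma balancing_subgroup_zero: "0 \<in> balancing_subgroup r l"
  using generate.one[of "free_Abelian_group UNIV"] by (simp add: balancing_subgroup_def)

lemma balancing_subgroup_relator: "x \<in> balancing_relators r l \<Longrightarrow> x \<in> balancing_subgroup r l"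
  by (simp add: balancing_subgroup_def generate.incl)

lemma balancing_subgroup_add:
  "x \<in> balancing_subgroup r l \<Longrightarrow> y \<in> balancing_subgroup r l \<Longrightarrow> x + y \<in> balancing_subgroup r l"
  using generate.eng[of x "free_Abelian_group UNIV"] by (simp add: balancing_subgroup_def)

lemma balancing_subgroup_uminus:
  assumes "x \<in> balancing_subgroup r l" shows "- x \<in> balancing_subgroup r l"
  using subgroup.m_inv_closed[OF normal_imp_subgroup[OF balancing_subgroup_normal] assms] by simp

lemma group_tensor_group: "group (tensor_group r l)"
  unfolding tensor_group_def by (intro normal.factorgroup_is_group balancing_subgroup_normal)

lemma mem_tensor_coset_iff:
  "x \<in> balancing_subgroup r l #>\<^bsub>free_Abelian_group UNIV\<^esub> y \<longleftrightarrow> x - y \<in> balancing_subgroup r l"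
proof
  assume "x - y \<in> balancing_subgroup r l"
  then show "x \<in> balancing_subgroup r l #>\<^bsub>free_Abelian_group UNIV\<^esub> y"
    unfolding r_coset_def by (auto intro!: bexI[of _ "x - y"])
qed (auto simp: r_coset_def)

lemma tensor_coset_eq_iff:
  "balancing_subgroup r l #>\<^bsub>free_Abelian_group UNIV\<^esub> x =
   balancing_subgroup r l #>\<^bsub>free_Abelian_group UNIV\<^esub> y \<longleftrightarrow> x - y \<in> balancing_subgroup r l"
  (is "?l \<longleftrightarrow> ?r")
proof
  assume ?l
  moreover have "x \<in> balancing_subgroup r l #>\<^bsub>free_Abelian_group UNIV\<^esub> x"
    by (simp add: mem_tensor_coset_iff balancing_subgroup_zero)
  ultimately have "x \<in> balancing_subgroup r l #>\<^bsub>free_Abelian_group UNIV\<^esub> y"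
    by blast
  then show ?r by (simp only: mem_tensor_coset_iff)
next
  assume ?r
  have "z - x \<in> balancing_subgroup r l \<longleftrightarrow> z - y \<in> balancing_subgroup r l" for z
    using balancing_subgroup_add[OF _ \<open>?r\<close>, of "z - x"]
      balancing_subgroup_add[OF _ balancing_subgroup_uminus[OF \<open>?r\<close>], of "z - y"]
    by auto
  then show ?l by (simp add: set_eq_iff mem_tensor_coset_iff)
qed

lemma pure_tensor_in_carrier: "pure_tensor r l m n \<in> carrier (tensor_group r l)"
  by (auto simp: tensor_group_def pure_tensor_def carrier_FactGroup)

lemma tensor_group_mult_coset:
  "(balancing_subgroup r l #>\<^bsub>free_Abelian_group UNIV\<^esub> x) \<otimes>\<^bsub>tensor_group r l\<^esub>
   (balancing_subgroup r l #>\<^bsub>free_Abelian_group UNIV\<^esub> y) =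
   balancing_subgroup r l #>\<^bsub>free_Abelian_group UNIV\<^esub> (x + y)"
  using normal.rcos_sum[OF balancing_subgroup_normal, of x y r l]
  by (simp add: tensor_group_def)

lemma frag_diff_diff_eq: "(x::'a \<Rightarrow>\<^sub>0 int) - (y + z) = x - y - z"
  by simp

lemma pure_tensor_add_left:
  "pure_tensor r l (m + m') n = pure_tensor r l m n \<otimes>\<^bsub>tensor_group r l\<^esub> pure_tensor r l m' n"
  unfolding pure_tensor_def tensor_group_mult_coset tensor_coset_eq_iff frag_diff_diff_eq
  by (rule balancing_subgroup_relator) (unfold balancing_relators_def, blast)

lemma pure_tensor_add_right:
  "pure_tensor r l m (n + n') = pure_tensor r l m n \<otimes>\<^bsub>tensor_group r l\<^esub> pure_tensor r l m n'"
  unfolding pure_tensor_def tensor_group_mult_coset tensor_coset_eq_iff frag_diff_diff_eq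
  by (rule balancing_subgroup_relator) (unfold balancing_relators_def, blast)

lemma pure_tensor_balanced: "pure_tensor r l (r m b) n = pure_tensor r l m (l b n)"
  unfolding pure_tensor_def tensor_coset_eq_iff
  by (rule balancing_subgroup_relator) (unfold balancing_relators_def, blast)

context
  fixes r :: "'m::ab_group_add \<Rightarrow> 'b \<Rightarrow> 'm" and l :: "'b \<Rightarrow> 'n::ab_group_add \<Rightarrow> 'n"
    and f :: "'m \<Rightarrow> 'm" and g :: "'n \<Rightarrow> 'n"
  assumes f: "\<And>m m'. f (m + m') = f m + f m'" "\<And>m b. f (r m b) = r (f m) b"
    and g: "\<And>n n'. g (n + n') = g n + g n'" "\<And>b n. g (l b n) = l b (g n)"
begin

lemma frag_extend_balancing_subgroup:
  assumes "x \<in> balancing_subgroup r l"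
  shows "frag_extend (\<lambda>(m, n). frag_of (f m, g n)) x \<in> balancing_subgroup r l"
proof -
  have rel: "frag_extend (\<lambda>(m, n). frag_of (f m, g n)) y \<in> balancing_subgroup r l"
    if "y \<in> balancing_relators r l" for y
  proof (rule balancing_subgroup_relator)
    have "(\<exists>m m' n. y = frag_of (m + m', n) - frag_of (m, n) - frag_of (m', n)) \<or>
        (\<exists>m n n'. y = frag_of (m, n + n') - frag_of (m, n) - frag_of (m, n')) \<or>
        (\<exists>m b n. y = frag_of (r m b, n) - frag_of (m, l b n))"
      using that unfolding balancing_relators_def by blast
    then show "frag_extend (\<lambda>(m, n). frag_of (f m, g n)) y \<in> balancing_relators r l"
    proof (elim disjE exE)
      fix m m' n assume "y = frag_of (m + m', n) - frag_of (m, n) - frag_of (m', n)"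
      then have "frag_extend (\<lambda>(m, n). frag_of (f m, g n)) y =
          frag_of (f m + f m', g n) - frag_of (f m, g n) - frag_of (f m', g n)"
        by (simp add: frag_extend_diff f)
      then show ?thesis unfolding balancing_relators_def by blast
    next
      fix m n n' assume "y = frag_of (m, n + n') - frag_of (m, n) - frag_of (m, n')"
      then have "frag_extend (\<lambda>(m, n). frag_of (f m, g n)) y =
          frag_of (f m, g n + g n') - frag_of (f m, g n) - frag_of (f m, g n')"
        by (simp add: frag_extend_diff g)
      then show ?thesis unfolding balancing_relators_def by blast
    next
      fix m b n assume "y = frag_of (r m b, n) - frag_of (m, l b n)"
      then have "frag_extend (\<lambda>(m, n). frag_of (f m, g n)) y =
          frag_of (r (f m) b, g n) - frag_of (f m, l b (g n))"
        by (simp add: frag_extend_diff f g)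
      then show ?thesis unfolding balancing_relators_def by blast
    qed
  qed
  have "x \<in> generate (free_Abelian_group UNIV) (balancing_relators r l)"
    using assms by (simp add: balancing_subgroup_def)
  then show ?thesis
    by (induction rule: generate.induct)
      (simp_all add: rel balancing_subgroup_zero balancing_subgroup_add balancing_subgroup_uminus
        frag_extend_add frag_extend_minus)
qed

lemma tensor_map_coset:
  "tensor_map r l f g (balancing_subgroup r l #>\<^bsub>free_Abelian_group UNIV\<^esub> x) =
   balancing_subgroup r l #>\<^bsub>free_Abelian_group UNIV\<^esub> frag_extend (\<lambda>(m, n). frag_of (f m, g n)) x"
proof -
  have "balancing_subgroup r l #>\<^bsub>free_Abelian_group UNIV\<^esub> frag_extend (\<lambda>(m, n). frag_of (f m, g n)) y =
      balancing_subgroup r l #>\<^bsub>free_Abelian_group UNIV\<^esub> frag_extend (\<lambda>(m, n). frag_of (f m, g n)) x"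
    if "y \<in> balancing_subgroup r l #>\<^bsub>free_Abelian_group UNIV\<^esub> x" for y
    using that frag_extend_balancing_subgroup[of "y - x"]
    by (simp add: tensor_coset_eq_iff mem_tensor_coset_iff frag_extend_diff)
  moreover have "x \<in> balancing_subgroup r l #>\<^bsub>free_Abelian_group UNIV\<^esub> x"
    by (simp add: mem_tensor_coset_iff balancing_subgroup_zero)
  ultimately show ?thesis
    unfolding tensor_map_def by blast
qed

lemma tensor_map_pure_tensor:
  "tensor_map r l f g (pure_tensor r l m n) = pure_tensor r l (f m) (g n)"
  by (simp add: pure_tensor_def tensor_map_coset)

lemma tensor_map_add:
  assumes "X \<in> carrier (tensor_group r l)" "Y \<in> carrier (tensor_group r l)"
  shows "tensor_map r l f g (X \<otimes>\<^bsub>tensor_group r l\<^esub> Y) =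
    tensor_map r l f g X \<otimes>\<^bsub>tensor_group r l\<^esub> tensor_map r l f g Y"
proof -
  obtain x y where "X = balancing_subgroup r l #>\<^bsub>free_Abelian_group UNIV\<^esub> x"
    "Y = balancing_subgroup r l #>\<^bsub>free_Abelian_group UNIV\<^esub> y"
    using assms by (auto simp: tensor_group_def carrier_FactGroup)
  then show ?thesis
    by (simp only: tensor_group_mult_coset tensor_map_coset frag_extend_add)
qed

end


section \<open>The matrices\<close>

text \<open>\<open>Mat2 a m n b\<close> is the matrix with rows \<open>(a, m)\<close> and \<open>(n, b)\<close>; here \<open>'n\<close> is the conjugate
  of the bimodule \<open>'m\<close>.\<close>

datatype ('a, 'm, 'n, 'b) mat2 = Mat2 'a 'm 'n 'b

instantiation mat2 :: (ab_group_add, ab_group_add, ab_group_add, ab_group_add) ab_group_add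
begin

definition zero_mat2 :: "('a, 'b, 'c, 'd) mat2" where
  "zero_mat2 = Mat2 0 0 0 0"

fun plus_mat2 :: "('a, 'b, 'c, 'd) mat2 \<Rightarrow> ('a, 'b, 'c, 'd) mat2 \<Rightarrow> ('a, 'b, 'c, 'd) mat2" where
  "plus_mat2 (Mat2 a m n b) (Mat2 a' m' n' b') = Mat2 (a + a') (m + m') (n + n') (b + b')"

fun minus_mat2 :: "('a, 'b, 'c, 'd) mat2 \<Rightarrow> ('a, 'b, 'c, 'd) mat2 \<Rightarrow> ('a, 'b, 'c, 'd) mat2" where
  "minus_mat2 (Mat2 a m n b) (Mat2 a' m' n' b') = Mat2 (a - a') (m - m') (n - n') (b - b')"

fun uminus_mat2 :: "('a, 'b, 'c, 'd) mat2 \<Rightarrow> ('a, 'b, 'c, 'd) mat2" where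
  "uminus_mat2 (Mat2 a m n b) = Mat2 (- a) (- m) (- n) (- b)"

instance
proof
  fix x y z :: "('a, 'b, 'c, 'd) mat2"
  show "x + y + z = x + (y + z)" by (cases x; cases y; cases z) (simp add: add.assoc)
  show "x + y = y + x" by (cases x; cases y) (simp add: add.commute)
  show "0 + x = x" by (cases x) (simp add: zero_mat2_def)
  show "- x + x = 0" by (cases x) (simp add: zero_mat2_def)
  show "x - y = x + - y" by (cases x; cases y) simp
qed

end

fun mat2_scale ::
    "(complex \<Rightarrow> 'a \<Rightarrow> 'a) \<Rightarrow> (complex \<Rightarrow> 'm \<Rightarrow> 'm) \<Rightarrow> (complex \<Rightarrow> 'n \<Rightarrow> 'n) \<Rightarrow> (complex \<Rightarrow> 'b \<Rightarrow> 'b) \<Rightarrow>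
     complex \<Rightarrow> ('a, 'm, 'n, 'b) mat2 \<Rightarrow> ('a, 'm, 'n, 'b) mat2" where
  "mat2_scale sA sM sN sB c (Mat2 a m n b) = Mat2 (sA c a) (sM c m) (sN c n) (sB c b)"

fun mat2_mult ::
    "('a::ab_group_add \<Rightarrow> 'a \<Rightarrow> 'a) \<Rightarrow> ('b::ab_group_add \<Rightarrow> 'b \<Rightarrow> 'b) \<Rightarrow>
     ('a \<Rightarrow> 'm::ab_group_add \<Rightarrow> 'm) \<Rightarrow> ('m \<Rightarrow> 'b \<Rightarrow> 'm) \<Rightarrow>
     ('b \<Rightarrow> 'n::ab_group_add \<Rightarrow> 'n) \<Rightarrow> ('n \<Rightarrow> 'a \<Rightarrow> 'n) \<Rightarrow>
     (('m \<times> 'n \<Rightarrow>\<^sub>0 int) set \<Rightarrow> 'a) \<Rightarrow> (('n \<times> 'm \<Rightarrow>\<^sub>0 int) set \<Rightarrow> 'b) \<Rightarrow>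
     ('a, 'm, 'n, 'b) mat2 \<Rightarrow> ('a, 'm, 'n, 'b) mat2 \<Rightarrow> ('a, 'm, 'n, 'b) mat2" where
  "mat2_mult mA mB lM rM lN rN \<phi> \<psi> (Mat2 a m n b) (Mat2 a' m' n' b') =
     Mat2 (mA a a' + \<phi> (pure_tensor rM lN m n')) (lM a m' + rM m b')
          (rN n a' + lN b n') (mB b b' + \<psi> (pure_tensor rN lM n m'))"

end

theory Submission
  imports Defs
begin

text \<open>Evaluated on pure tensors, \<open>\<phi>\<close> and \<open>\<psi>\<close> are biadditive, balanced and bilinear over the outer
  algebras. Products of off-diagonal entries are associative by the compatibility
  \<open>\<phi> (m \<otimes> \<epsilon> n) p = m \<psi> (\<epsilon> n \<otimes> p)\<close> and by its mirror image
  \<open>\<psi> (\<epsilon> n \<otimes> m) (\<epsilon> p) = \<epsilon> n \<phi> (m \<otimes> \<epsilon> p)\<close>, which follows by applying \<open>\<epsilon>\<close> to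
  \<open>p \<psi> (\<epsilon> m \<otimes> n) = \<phi> (p \<otimes> \<epsilon> m) n\<close> and using the symmetry of \<open>\<phi>\<close> and \<open>\<psi>\<close> under the
  involutions. The two pairings thus form a Morita context.\<close>

locale tensor_pairing =
  M: bimodule sA mA eA sB mB eB sM lM rM + N: bimodule sB mB eB sA mA eA sN lN rN
  for sA :: "complex \<Rightarrow> 'a::ab_group_add \<Rightarrow> 'a" and mA eA
    and sB :: "complex \<Rightarrow> 'b::ab_group_add \<Rightarrow> 'b" and mB eB
    and sM :: "complex \<Rightarrow> 'm::ab_group_add \<Rightarrow> 'm" and lM rM
    and sN :: "complex \<Rightarrow> 'n::ab_group_add \<Rightarrow> 'n" and lN rN +
  fixes \<phi> :: "('m \<times> 'n \<Rightarrow>\<^sub>0 int) set \<Rightarrow> 'a"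
  assumes hom: "tensor_bimodule_hom lM rM lN rN mA \<phi>"
begin

abbreviation pairing :: "'m \<Rightarrow> 'n \<Rightarrow> 'a" where
  "pairing m n \<equiv> \<phi> (pure_tensor rM lN m n)"

lemma pairing_add_left: "pairing (m + m') n = pairing m n + pairing m' n"
  using hom by (simp add: tensor_bimodule_hom_def pure_tensor_add_left pure_tensor_in_carrier)

lemma pairing_add_right: "pairing m (n + n') = pairing m n + pairing m n'"
  using hom by (simp add: tensor_bimodule_hom_def pure_tensor_add_right pure_tensor_in_carrier)

lemma pairing_balanced: "pairing (rM m b) n = pairing m (lN b n)"
  by (simp add: pure_tensor_balanced)

text \<open>Left multiplication by \<open>a\<close> commutes with \<open>rM\<close> because
  \<open>M\<close> is a bimodule, so \<open>tensor_map\<close> acts factorwise on pure tensors and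
  linearity of \<open>\<phi>\<close> applies.\<close>

lemma pairing_act_left: "pairing (lM a m) n = mA a (pairing m n)"
proof -
  have "tensor_map rM lN (lM a) id (pure_tensor rM lN m n) = pure_tensor rM lN (lM a m) (id n)"
    by (rule tensor_map_pure_tensor) (simp_all add: M.l_add_right M.lr_assoc)
  then show ?thesis
    using hom pure_tensor_in_carrier[of rM lN m n] unfolding tensor_bimodule_hom_def
    by (metis id_apply)
qed

lemma pairing_act_right: "pairing m (rN n a) = mA (pairing m n) a"
proof -
  have "tensor_map rM lN id (\<lambda>n. rN n a) (pure_tensor rM lN m n) = pure_tensor rM lN (id m) (rN n a)"
    by (rule tensor_map_pure_tensor) (simp_all add: N.r_add_left N.lr_assoc)
  then show ?thesis
    using hom pure_tensor_in_carrier[of rM lN m n] unfolding tensor_bimodule_hom_def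
    by (metis id_apply)
qed

text \<open>\<open>tensor_bimodule_hom\<close> does not mention scalars; since \<open>c\<close> acts
  on \<open>M\<close> as \<open>sA c eA\<close>, this is a case of linearity over
  \<open>A\<close>.\<close>

lemma pairing_scale_left: "pairing (sM c m) n = sA c (pairing m n)"
  using pairing_act_left[of "sA c eA" m n]
  by (simp add: M.l_scale_left M.l_unit M.A.mult_scale_left M.A.mult_unit_left)

lemma pairing_scale_right: "pairing m (sN c n) = sA c (pairing m n)"
  using pairing_act_right[of m n "sA c eA"]
  by (simp add: N.r_scale_right N.r_unit M.A.mult_scale_right M.A.mult_unit_right)

lemma pairing_zero_left: "pairing 0 n = 0"
  using pairing_add_left[of 0 0 n] by simp

lemma pairing_zero_right: "pairing m 0 = 0"
  using pairing_add_right[of m 0 0] by simp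

end

context bimodule
begin

lemma l_zero_right: "lM a 0 = 0"
  using l_add_right[of a 0 0] by simp

lemma r_zero_left: "rM 0 b = 0"
  using r_add_left[of 0 0 b] by simp

end

text \<open>Stated for an arbitrary Morita context, so that the hypotheses are symmetric under
  exchanging \<open>A\<close> with \<open>B\<close> and \<open>M\<close> with \<open>N\<close>; the
  axioms are then checked entry by entry.\<close>

lemma unital_assoc_algebra_mat2:
  assumes \<phi>: "tensor_pairing sA mA eA sB mB eB sM lM rM sN lN rN \<phi>"
    and \<psi>: "tensor_pairing sB mB eB sA mA eA sN lN rN sM lM rM \<psi>"
    and assoc_M: "\<And>m n p. lM (\<phi> (pure_tensor rM lN m n)) p = rM m (\<psi> (pure_tensor rN lM n p))"
    and assoc_N: "\<And>n m p. lN (\<psi> (pure_tensor rN lM n m)) p = rN n (\<phi> (pure_tensor rM lN m p))"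
  shows "unital_assoc_algebra (mat2_scale sA sM sN sB) (mat2_mult mA mB lM rM lN rN \<phi> \<psi>)
    (Mat2 eA 0 0 eB)"
proof -
  interpret P: tensor_pairing sA mA eA sB mB eB sM lM rM sN lN rN \<phi> by fact
  interpret Q: tensor_pairing sB mB eB sA mA eA sN lN rN sM lM rM \<psi> by fact
  note scale = P.M.A.vector_space_assms P.M.B.vector_space_assms
    P.M.vector_space_assms P.N.vector_space_assms
  note bilinear = P.M.A.mult_add_left P.M.A.mult_add_right P.M.B.mult_add_left P.M.B.mult_add_right
    P.M.l_add_left P.M.l_add_right P.M.r_add_left P.M.r_add_right
    P.N.l_add_left P.N.l_add_right P.N.r_add_left P.N.r_add_right
    P.pairing_add_left P.pairing_add_right Q.pairing_add_left Q.pairing_add_right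
    P.M.A.mult_scale_left P.M.A.mult_scale_right P.M.B.mult_scale_left P.M.B.mult_scale_right
    P.M.l_scale_left P.M.l_scale_right P.M.r_scale_left P.M.r_scale_right
    P.N.l_scale_left P.N.l_scale_right P.N.r_scale_left P.N.r_scale_right
    P.pairing_scale_left P.pairing_scale_right Q.pairing_scale_left Q.pairing_scale_right
  \<comment> \<open>In a triple product, the diagonal entries need the pairings to be balanced and
    linear over the outer algebras. \<open>assoc_M\<close> settles the term
    \<open>\<phi>(m, n') m''\<close> of the upper right entry, \<open>assoc_N\<close> the term
    \<open>\<psi>(n, m') n''\<close> of the lower left one.\<close>
  note assoc = P.M.A.mult_assoc P.M.B.mult_assoc P.M.l_mult P.M.r_mult P.M.lr_assoc
    P.N.l_mult P.N.r_mult P.N.lr_assoc P.pairing_balanced Q.pairing_balanced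
    P.pairing_act_left P.pairing_act_right Q.pairing_act_left Q.pairing_act_right assoc_M assoc_N
  note unit = P.M.A.mult_unit_left P.M.A.mult_unit_right P.M.B.mult_unit_left P.M.B.mult_unit_right
    P.M.l_unit P.M.r_unit P.N.l_unit P.N.r_unit
    P.M.l_zero_right P.M.r_zero_left P.N.l_zero_right P.N.r_zero_left
    P.pairing_zero_left P.pairing_zero_right Q.pairing_zero_left Q.pairing_zero_right
  let ?s = "mat2_scale sA sM sN sB" and ?m = "mat2_mult mA mB lM rM lN rN \<phi> \<psi>"
    and ?E = "Mat2 eA 0 0 eB"
  show ?thesis
  proof
    fix c d x y z
    show "?s c (x + y) = ?s c x + ?s c y" by (cases x; cases y) (simp add: scale)
    show "?s (c + d) x = ?s c x + ?s d x" by (cases x) (simp add: scale)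
    show "?s c (?s d x) = ?s (c * d) x" by (cases x) (simp add: scale)
    show "?s 1 x = x" by (cases x) (simp add: scale)
    show "?m (x + y) z = ?m x z + ?m y z"
      by (cases x; cases y; cases z) (simp add: bilinear ac_simps)
    show "?m x (y + z) = ?m x y + ?m x z"
      by (cases x; cases y; cases z) (simp add: bilinear ac_simps)
    show "?m (?s c x) y = ?s c (?m x y)" by (cases x; cases y) (simp add: bilinear scale)
    show "?m x (?s c y) = ?s c (?m x y)" by (cases x; cases y) (simp add: bilinear scale)
    show "?m (?m x y) z = ?m x (?m y z)"
      by (cases x; cases y; cases z) (simp add: bilinear assoc ac_simps)
    show "?m ?E x = x" by (cases x) (simp add: unit)
    show "?m x ?E = x" by (cases x) (simp add: unit)
  qed
qed

theorem proposition3p4: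
  fixes \<sigma> :: "complex \<Rightarrow> complex"
    and sA :: "complex \<Rightarrow> 'a::ab_group_add \<Rightarrow> 'a" and mA :: "'a \<Rightarrow> 'a \<Rightarrow> 'a"
    and eA :: 'a and starA :: "'a \<Rightarrow> 'a"
    and sB :: "complex \<Rightarrow> 'b::ab_group_add \<Rightarrow> 'b" and mB :: "'b \<Rightarrow> 'b \<Rightarrow> 'b"
    and eB :: 'b and starB :: "'b \<Rightarrow> 'b"
    and sM :: "complex \<Rightarrow> 'm::ab_group_add \<Rightarrow> 'm"
    and lM :: "'a \<Rightarrow> 'm \<Rightarrow> 'm" and rM :: "'m \<Rightarrow> 'b \<Rightarrow> 'm"
    and \<epsilon> :: "'m \<Rightarrow> 'n::ab_group_add"
    and sN :: "complex \<Rightarrow> 'n \<Rightarrow> 'n"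
    and lN :: "'b \<Rightarrow> 'n \<Rightarrow> 'n" and rN :: "'n \<Rightarrow> 'a \<Rightarrow> 'n"
    and \<phi> :: "('m \<times> 'n \<Rightarrow>\<^sub>0 int) set \<Rightarrow> 'a"
    and \<psi> :: "('n \<times> 'm \<Rightarrow>\<^sub>0 int) set \<Rightarrow> 'b"
  assumes "\<sigma> = id \<or> \<sigma> = cnj"
    and "involutive_algebra \<sigma> sA mA eA starA"
    and "involutive_algebra \<sigma> sB mB eB starB"
    and "bimodule sA mA eA sB mB eB sM lM rM"
    and "conjugate_bimodule \<sigma> starA starB sM lM rM \<epsilon> sN lN rN"
    and "tensor_bimodule_hom lM rM lN rN mA \<phi>"
    and "tensor_bimodule_hom lN rN lM rM mB \<psi>"
    and "\<And>m n. starA (\<phi> (pure_tensor rM lN m (\<epsilon> n))) = \<phi> (pure_tensor rM lN n (\<epsilon> m))"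
    and "\<And>m n. starB (\<psi> (pure_tensor rN lM (\<epsilon> m) n)) = \<psi> (pure_tensor rN lM (\<epsilon> n) m)"
    and "\<And>m n p. lM (\<phi> (pure_tensor rM lN m (\<epsilon> n))) p = rM m (\<psi> (pure_tensor rN lM (\<epsilon> n) p))"
  shows "unital_assoc_algebra (mat2_scale sA sM sN sB) (mat2_mult mA mB lM rM lN rN \<phi> \<psi>)
           (Mat2 eA 0 (\<epsilon> 0) eB)"
proof -
  interpret M: bimodule sA mA eA sB mB eB sM lM rM by fact
  interpret N: conjugate_bimodule \<sigma> starA starB sM lM rM \<epsilon> sN lN rN by fact
  interpret N: bimodule sB mB eB sA mA eA sN lN rN
    by (rule conjugate_bimodule_is_bimodule) fact+
  have surj: "\<exists>m. n = \<epsilon> m" for n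
    using bij_is_surj[OF N.bij_eps] by (simp add: surj_def)
  \<comment> \<open>Every element of \<open>'n\<close> has the form \<open>\<epsilon> n'\<close>, so
    the compatibility hypothesis covers all second arguments.\<close>
  have "lM (\<phi> (pure_tensor rM lN m n)) p = rM m (\<psi> (pure_tensor rN lM n p))" for m n p
    using surj[of n] assms(10) by auto
  moreover have "lN (\<psi> (pure_tensor rN lM n m)) p = rN n (\<phi> (pure_tensor rM lN m p))" for n m p
  proof -
    obtain n' p' where "n = \<epsilon> n'" "p = \<epsilon> p'"
      using surj by meson
    \<comment> \<open>Moving the actions through \<open>\<epsilon>\<close> applies the involutions
      to the pairings, which swaps their arguments; both sides become \<open>\<epsilon> (rM p'
      (\<psi> (pure_tensor rN lM (\<epsilon> m) n')))\<close>.\<close>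
    then show ?thesis
      by (simp add: N.act_eps N.eps_act assms(8-10))
  qed
  \<comment> \<open>This identifies the lower left entry of the unit matrix with the zero used in
    \<open>unital_assoc_algebra_mat2\<close>.\<close>
  moreover have "\<epsilon> 0 = 0"
    using N.eps_add[of 0 0] by simp
  ultimately show ?thesis
    using assms(6,7) M.bimodule_axioms N.bimodule_axioms
    by (simp only:, intro unital_assoc_algebra_mat2) (simp_all add: tensor_pairing_def tensor_pairing_axioms_def)
qed

end
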